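(* The quaternion group $Q_8=\langle i,j,k\mid ijk^{-1},\, jki^{-1},\, kij^{-1},\, i^4\rangle$ is, up to isomorphism, the only non-abelian 2-generator group with piecewise excluding geodesic language for all finite symmetric generating sets. That is, for a non-abelian group $G$ generated by two elements, the language $\mathsf{Geo}(G,A)$ is piecewise excluding for every finite symmetric generating set $A$ of $G$ if and only if $G\cong Q_8$.
   Context: A generating set $A$ of a group $G$ is symmetric if it is inverse-closed: $A$ is a subset of $G$ generating $G$ and $a\in A$ implies $a^{-1}\in A$ (the identity element is allowed to belong to $A$). $A^*$ denotes the set of all finite words over the alphabet $A$, including the empty word. A word $w\in A^*$ is geodesic if it labels a path of minimal length between two vertices of the Cayley graph of $G$ over $A$; equivalently, no strictly shorter word over $A$ represents the same element of $G$ as $w$. The geodesic language $\mathsf{Geo}(G,A)\subseteq A^*$ is the set of all geodesic words. A word $a_1a_2\cdots a_n$ ($a_i\in A$) is a piecewise subword of $w\in A^*$ if $w=w_0a_1w_1a_2\cdots a_nw_n$ for some $w_i\in A^*$ (i.e. it is a not necessarily contiguous subsequence of $w$). A language $L\subseteq A^*$ is piecewise excluding if there is a finite set $F\subset A^*$ such that, for all $w\in A^*$, $w\in L$ if and only if $w$ contains no piecewise subword in $F$. *)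

theory Defs
  imports "HOL-Algebra.Generated_Groups" "HOL-Library.Sublist"
begin

section \<open>Words, Cayley graphs and geodesic languages\<close>

text \<open>
  Words over an alphabet \<open>A\<close> are the elements of \<open>lists A\<close>; piecewise subwords are
  the relation \<^const>\<open>subseq\<close>.
\<close>

definition piecewise_excluding :: "'a set \<Rightarrow> 'a list set \<Rightarrow> bool" where
  "piecewise_excluding A L \<longleftrightarrow> L \<subseteq> lists A \<and>
     (\<exists>F. finite F \<and> F \<subseteq> lists A \<and>
          (\<forall>w\<in>lists A. w \<in> L \<longleftrightarrow> \<not> (\<exists>f\<in>F. subseq f w)))"

definition symmetric_generating_set :: "('a, 'b) monoid_scheme \<Rightarrow> 'a set \<Rightarrow> bool" where
  "symmetric_generating_set G A \<longleftrightarrow>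
     A \<subseteq> carrier G \<and> generate G A = carrier G \<and> (\<forall>a\<in>A. inv\<^bsub>G\<^esub> a \<in> A)"

text \<open>
  \<open>cayley_path G A g w h\<close>: starting at the vertex \<open>g\<close> of the (right) Cayley graph of \<open>G\<close>
  over \<open>A\<close>, whose edges are \<open>g \<rightarrow> g \<otimes> a\<close> with label \<open>a \<in> A\<close>, the path labelled by the
  word \<open>w\<close> ends at the vertex \<open>h\<close>.
\<close>

inductive cayley_path ::
  "('a, 'b) monoid_scheme \<Rightarrow> 'a set \<Rightarrow> 'a \<Rightarrow> 'a list \<Rightarrow> 'a \<Rightarrow> bool"
  for G (structure) and A where
  Nil: "g \<in> carrier G \<Longrightarrow> cayley_path G A g [] g"
| Cons: "g \<in> carrier G \<Longrightarrow> a \<in> A \<Longrightarrow> cayley_path G A (g \<otimes> a) w h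
           \<Longrightarrow> cayley_path G A g (a # w) h"

definition Geo :: "('a, 'b) monoid_scheme \<Rightarrow> 'a set \<Rightarrow> 'a list set" where
  "Geo G A = {w. \<exists>g h. cayley_path G A g w h \<and>
                   (\<forall>v. cayley_path G A g v h \<longrightarrow> length w \<le> length v)}"

lemma (in monoid) word_closed:
  "w \<in> lists (carrier G) \<Longrightarrow> foldr (\<otimes>) w \<one> \<in> carrier G"
  by (induction w) auto

lemma (in monoid) cayley_path_iff:
  assumes A: "A \<subseteq> carrier G"
  shows "cayley_path G A g w h \<longleftrightarrow>
           g \<in> carrier G \<and> w \<in> lists A \<and> h = g \<otimes> foldr (\<otimes>) w \<one>"
proof (induction w arbitrary: g)
  case Nil
  show ?case by (subst cayley_path.simps) auto
next
  case (Cons a w)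
  show ?case
  proof (cases "g \<in> carrier G \<and> a \<in> A \<and> w \<in> lists A")
    case True
    then have "a \<in> carrier G" "foldr (\<otimes>) w \<one> \<in> carrier G"
      using A word_closed[of w] by auto
    then show ?thesis
      using True Cons.IH[of "g \<otimes> a"] by (subst cayley_path.simps) (auto simp: m_assoc)
  next
    case False
    then show ?thesis
      using Cons.IH[of "g \<otimes> a"] by (subst cayley_path.simps) auto
  qed
qed

lemma (in group) Geo_iff:
  assumes A: "A \<subseteq> carrier G"
  shows "w \<in> Geo G A \<longleftrightarrow> w \<in> lists A \<and>
           \<not> (\<exists>v\<in>lists A. length v < length w \<and> foldr (\<otimes>) v \<one> = foldr (\<otimes>) w \<one>)"
proof -
  have "foldr (\<otimes>) v \<one> \<in> carrier G" if "v \<in> lists A" for v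
    using A that word_closed[of v] by auto
  then have "(g \<otimes> foldr (\<otimes>) v \<one> = g \<otimes> foldr (\<otimes>) u \<one>)
      \<longleftrightarrow> foldr (\<otimes>) v \<one> = foldr (\<otimes>) u \<one>"
    if "g \<in> carrier G" "v \<in> lists A" "u \<in> lists A" for g u v
    using that by simp
  then show ?thesis
    unfolding Geo_def cayley_path_iff[OF A] mem_Collect_eq
    by (metis linorder_not_le one_closed)
qed


section \<open>Group presentations\<close>

text \<open>
  The generators are the elements of the type \<open>'g\<close>; the letter \<open>(x, True)\<close> stands for \<open>x\<close>
  and \<open>(x, False)\<close> for its formal inverse.  \<open>pres_eq R u v\<close> says that \<open>u\<close> and \<open>v\<close> represent
  the same element of the group presented by the relators \<open>R\<close>.
\<close>

inductive pres_eq :: "('g \<times> bool) list set \<Rightarrow> ('g \<times> bool) list \<Rightarrow> ('g \<times> bool) list \<Rightarrow> bool"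
  for R where
  refl: "pres_eq R w w"
| sym: "pres_eq R u v \<Longrightarrow> pres_eq R v u"
| trans: "pres_eq R u v \<Longrightarrow> pres_eq R v w \<Longrightarrow> pres_eq R u w"
| cancel: "pres_eq R (u @ [(x, b), (x, \<not> b)] @ v) (u @ v)"
| relator: "r \<in> R \<Longrightarrow> pres_eq R (u @ r @ v) (u @ v)"

definition presented_group :: "('g \<times> bool) list set \<Rightarrow> ('g \<times> bool) list set monoid" where
  "presented_group R =
     \<lparr>carrier = range (\<lambda>u. Collect (pres_eq R u)),
      mult = (\<lambda>X Y. {w. \<exists>u\<in>X. \<exists>v\<in>Y. pres_eq R (u @ v) w}),
      one = Collect (pres_eq R [])\<rparr>"

lemma pres_eq_context: "pres_eq R u v \<Longrightarrow> pres_eq R (p @ u @ q) (p @ v @ q)"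
proof (induction rule: pres_eq.induct)
  case (cancel u x b v)
  show ?case using pres_eq.cancel[of R "p @ u" x b "v @ q"] by simp
next
  case (relator r u v)
  then show ?case using pres_eq.relator[of r R "p @ u" "v @ q"] by simp
qed (blast intro: pres_eq.intros)+

lemma pres_eq_append: "pres_eq R u u' \<Longrightarrow> pres_eq R v v' \<Longrightarrow> pres_eq R (u @ v) (u' @ v')"
  using pres_eq_context[of R u u' "[]" v] pres_eq_context[of R v v' u' "[]"]
  by (auto intro: pres_eq.trans)

lemma pres_class_eq: "Collect (pres_eq R u) = Collect (pres_eq R v) \<longleftrightarrow> pres_eq R u v"
  by (auto intro: pres_eq.intros)

lemma pres_class_mult:
  "Collect (pres_eq R u) \<otimes>\<^bsub>presented_group R\<^esub> Collect (pres_eq R v) = Collect (pres_eq R (u @ v))"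
  unfolding presented_group_def
  by (auto intro: pres_eq_append pres_eq.intros)

lemma group_presented_group: "group (presented_group R)"
proof (rule groupI)
  let ?c = "\<lambda>u. Collect (pres_eq R u)"
  have carr: "carrier (presented_group R) = range ?c"
    and one: "\<one>\<^bsub>presented_group R\<^esub> = ?c []"
    by (simp_all add: presented_group_def)
  show "x \<otimes>\<^bsub>presented_group R\<^esub> y \<in> carrier (presented_group R)"
    if "x \<in> carrier (presented_group R)" "y \<in> carrier (presented_group R)" for x y
    using that by (auto simp: carr pres_class_mult)
  show "\<one>\<^bsub>presented_group R\<^esub> \<in> carrier (presented_group R)"
    by (simp add: carr one)
  show "x \<otimes>\<^bsub>presented_group R\<^esub> y \<otimes>\<^bsub>presented_group R\<^esub> z =
        x \<otimes>\<^bsub>presented_group R\<^esub> (y \<otimes>\<^bsub>presented_group R\<^esub> z)"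
    if "x \<in> carrier (presented_group R)" "y \<in> carrier (presented_group R)"
       "z \<in> carrier (presented_group R)" for x y z
    using that by (auto simp: carr pres_class_mult)
  show "\<one>\<^bsub>presented_group R\<^esub> \<otimes>\<^bsub>presented_group R\<^esub> x = x"
    if "x \<in> carrier (presented_group R)" for x
    using that by (auto simp: carr one pres_class_mult)
  have "\<exists>v. pres_eq R (v @ u) []" for u
  proof (induction u)
    case Nil
    show ?case by (rule exI[of _ "[]"]) (simp add: pres_eq.refl)
  next
    case (Cons a u)
    obtain x b where a: "a = (x, b)" by (cases a)
    from Cons.IH obtain v where v: "pres_eq R (v @ u) []" by blast
    have "pres_eq R ((v @ [(x, \<not> b)]) @ a # u) (v @ u)"
      using pres_eq.cancel[of R v x "\<not> b" u] a by simp
    with v show ?case by (blast intro: pres_eq.trans)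
  qed
  then show "\<exists>y\<in>carrier (presented_group R). y \<otimes>\<^bsub>presented_group R\<^esub> x = \<one>\<^bsub>presented_group R\<^esub>"
    if "x \<in> carrier (presented_group R)" for x
    using that by (auto simp: carr one pres_class_mult pres_class_eq)
qed


section \<open>The quaternion group\<close>

datatype quat_gen = Qi | Qj | Qk

definition Q8_relators :: "(quat_gen \<times> bool) list set" where
  "Q8_relators =
     {[(Qi, True), (Qj, True), (Qk, False)],
      [(Qj, True), (Qk, True), (Qi, False)],
      [(Qk, True), (Qi, True), (Qj, False)],
      [(Qi, True), (Qi, True), (Qi, True), (Qi, True)]}"

definition Q8 :: "(quat_gen \<times> bool) list set monoid" where
  "Q8 = presented_group Q8_relators"

lemma group_Q8: "group Q8"
  unfolding Q8_def by (rule group_presented_group)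

text \<open>
  The presentation does not collapse: the letters act on \<open>\<int>\<^sup>4\<close> by right multiplication of
  integer quaternions.
\<close>

fun quat_act :: "quat_gen \<times> bool \<Rightarrow> int \<times> int \<times> int \<times> int \<Rightarrow> int \<times> int \<times> int \<times> int" where
  "quat_act (Qi, True) (a, b, c, d) = (- b, a, d, - c)"
| "quat_act (Qj, True) (a, b, c, d) = (- c, - d, a, b)"
| "quat_act (Qk, True) (a, b, c, d) = (- d, c, - b, a)"
| "quat_act (Qi, False) (a, b, c, d) = (b, - a, - d, c)"
| "quat_act (Qj, False) (a, b, c, d) = (c, d, - a, - b)"
| "quat_act (Qk, False) (a, b, c, d) = (d, - c, b, - a)"

lemma Q8_not_comm: "\<not> comm_group Q8"
proof
  define R where "R = Q8_relators"
  have act: "fold quat_act u s = fold quat_act v s" if "pres_eq R u v" for u v s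
    using that
  proof (induction arbitrary: s rule: pres_eq.induct)
    case (cancel u x b v)
    have "quat_act (x, \<not> b) (quat_act (x, b) t) = t" for t
      by (cases x; cases b; cases t) auto
    then show ?case by simp
  next
    case (relator r u v)
    have "fold quat_act r t = t" for t
      using relator by (cases t) (auto simp: R_def Q8_relators_def)
    then show ?case by simp
  qed auto
  assume "comm_group Q8"
  then interpret comm_group Q8 .
  let ?i = "Collect (pres_eq R [(Qi, True)])" and ?j = "Collect (pres_eq R [(Qj, True)])"
  have Q: "Q8 = presented_group R" by (simp add: Q8_def R_def)
  have "?i \<in> carrier Q8" "?j \<in> carrier Q8"
    by (auto simp: Q presented_group_def)
  moreover have
    "?i \<otimes>\<^bsub>Q8\<^esub> ?j = Collect (pres_eq R [(Qi, True), (Qj, True)])"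
    "?j \<otimes>\<^bsub>Q8\<^esub> ?i = Collect (pres_eq R [(Qj, True), (Qi, True)])"
    by (simp_all add: Q pres_class_mult)
  ultimately have "pres_eq R [(Qi, True), (Qj, True)] [(Qj, True), (Qi, True)]"
    using m_comm[of ?i ?j] by (simp add: pres_class_eq pres_eq.sym)
  from act[OF this, of "(1, 0, 0, 0)"] show False by simp
qed

lemma Q8_two_generated: "\<exists>x\<in>carrier Q8. \<exists>y\<in>carrier Q8. generate Q8 {x, y} = carrier Q8"
proof -
  define R where "R = Q8_relators"
  have Q: "Q8 = presented_group R" by (simp add: Q8_def R_def)
  interpret group Q8 by (rule group_Q8)
  let ?c = "\<lambda>u. Collect (pres_eq R u)"
  let ?S = "{?c [(Qi, True)], ?c [(Qj, True)]}"
  let ?H = "generate Q8 ?S"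
  have carr: "carrier Q8 = range ?c" and one: "\<one>\<^bsub>Q8\<^esub> = ?c []"
    by (simp_all add: Q presented_group_def)
  have mult: "?c u \<otimes>\<^bsub>Q8\<^esub> ?c v = ?c (u @ v)" for u v
    by (simp add: Q pres_class_mult)
  have S: "?S \<subseteq> carrier Q8" by (auto simp: carr)
  have H: "subgroup ?H Q8" by (rule generate_is_subgroup[OF S])
  have ij: "?c [(Qi, True)] \<in> ?H" "?c [(Qj, True)] \<in> ?H"
    by (auto intro: generate.incl)
  have "pres_eq R ([(Qi, True), (Qj, True), (Qk, False)] @ [(Qk, True)]) [(Qk, True)]"
    using pres_eq.relator[of "[(Qi, True), (Qj, True), (Qk, False)]" R "[]" "[(Qk, True)]"]
    by (simp add: R_def Q8_relators_def)
  moreover have "pres_eq R ([(Qi, True), (Qj, True), (Qk, False)] @ [(Qk, True)]) [(Qi, True), (Qj, True)]"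
    using pres_eq.cancel[of R "[(Qi, True), (Qj, True)]" Qk False "[]"] by simp
  ultimately have "?c [(Qk, True)] = ?c [(Qi, True)] \<otimes>\<^bsub>Q8\<^esub> ?c [(Qj, True)]"
    unfolding mult pres_class_eq by (auto intro: pres_eq.intros)
  then have pos: "?c [(x, True)] \<in> ?H" for x
    using ij by (cases x) (auto intro: generate.eng)
  have inv: "?c [(x, False)] = inv\<^bsub>Q8\<^esub> ?c [(x, True)]" for x
  proof (rule inv_equality[symmetric])
    show "?c [(x, False)] \<otimes>\<^bsub>Q8\<^esub> ?c [(x, True)] = \<one>\<^bsub>Q8\<^esub>"
      using pres_eq.cancel[of R "[]" x False "[]"] by (simp add: mult one pres_class_eq)
  qed (auto simp: carr)
  have letter: "?c [a] \<in> ?H" for a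
    using pos inv subgroup.m_inv_closed[OF H pos]
    by (cases a; cases "snd a") auto
  have "?c u \<in> ?H" for u
  proof (induction u)
    case Nil
    show ?case using generate.one[of Q8 ?S] by (simp add: one)
  next
    case (Cons a u)
    then show ?case
      using generate.eng[OF letter[of a] Cons] by (simp add: mult)
  qed
  then have "?H = carrier Q8"
    using generate_incl[OF S] by (auto simp: carr)
  then show ?thesis using S by blast
qed

end

theory Submission
  imports Defs "HOL-Algebra.Multiplicative_Group"
begin

text \<open>
  If \<open>Geo(G, A)\<close> is piecewise excluding for \<open>A = {x, x\<^sup>-\<^sup>1, y, y\<^sup>-\<^sup>1}\<close>, then it is closed under
  piecewise subwords, so \<open>x y x\<^sup>-\<^sup>1\<close>, which contains \<open>x x\<^sup>-\<^sup>1\<close>, is not geodesic and equals a word of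
  length at most 2.  For noncommuting \<open>x\<close>, \<open>y\<close> this leaves seven relations, and every generating pair
  of \<open>G\<close> has to satisfy one of them.  Feeding a relation for \<open>(x, y)\<close> into
  the alternatives for a second pair such as \<open>(x, y x)\<close>, \<open>(x\<^sup>-\<^sup>1, y)\<close> or \<open>(x y, y)\<close> eliminates
  all of them except \<open>y x y = x\<close>.  By symmetry \<open>x y x = y\<close>, and these two relations
  force a nonabelian group to be \<open>Q\<^sub>8\<close>.

  Conversely, any two noncommuting elements \<open>a\<close>, \<open>b\<close> of \<open>Q\<^sub>8\<close> satisfy the same relations, so every
  element is a product of at most two factors from \<open>{a, a\<^sup>-\<^sup>1, b, b\<^sup>-\<^sup>1}\<close>.  In a Cayley graph of diameter
  at most 2 the proper piecewise subwords of a geodesic are contiguous, hence geodesic.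
\<close>

section \<open>Generating pairs\<close>

context group
begin

lemma commutes_generate:
  assumes "g \<in> generate G A" "A \<subseteq> carrier G" "h \<in> carrier G"
    and "\<And>a. a \<in> A \<Longrightarrow> a \<otimes> h = h \<otimes> a"
  shows "g \<otimes> h = h \<otimes> g"
  using assms(1)
proof induction
  case one
  then show ?case using assms(3) by simp
next
  case (incl a)
  then show ?case by (rule assms(4))
next
  case (inv a)
  with assms(2) have "a \<in> carrier G" by auto
  then show ?case using assms(3) assms(4)[OF inv]
    by (metis inv_closed inv_solve_left inv_solve_right m_assoc m_closed)
next
  case (eng g g')
  with assms(2) have "g \<in> carrier G" "g' \<in> carrier G"
    using generate_in_carrier by auto
  then show ?case using eng.IH assms(3) by (metis m_assoc)
qed

text \<open>Commutation passes from the generators to the whole group one argument at a time, by two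
  uses of \<open>commutes_generate\<close>.\<close>

lemma comm_group_generateI:
  assumes "A \<subseteq> carrier G" "generate G A = carrier G"
    and "\<And>a b. a \<in> A \<Longrightarrow> b \<in> A \<Longrightarrow> a \<otimes> b = b \<otimes> a"
  shows "comm_group G"
proof (rule group_comm_groupI)
  fix g h assume "g \<in> carrier G" "h \<in> carrier G"
  moreover from this have "a \<otimes> h = h \<otimes> a" if "a \<in> A" for a
    using commutes_generate[of h A a] assms that by (metis subsetD)
  ultimately show "g \<otimes> h = h \<otimes> g"
    using commutes_generate[of g A h] assms by metis
qed

definition gen_pair :: "'a \<Rightarrow> 'a \<Rightarrow> bool" where
  "gen_pair x y \<longleftrightarrow> x \<in> carrier G \<and> y \<in> carrier G \<and> generate G {x, y} = carrier G"

lemma gen_pair_closed: "gen_pair x y \<Longrightarrow> x \<in> carrier G" "gen_pair x y \<Longrightarrow> y \<in> carrier G"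
  by (simp_all add: gen_pair_def)

lemma gen_pair_transfer:
  assumes "gen_pair x y" "u \<in> carrier G" "v \<in> carrier G"
    "x \<in> generate G {u, v}" "y \<in> generate G {u, v}"
  shows "gen_pair u v"
proof -
  have "generate G {x, y} \<subseteq> generate G {u, v}"
    using assms by (intro generate_subgroup_incl generate_is_subgroup) auto
  moreover have "generate G {u, v} \<subseteq> carrier G"
    using assms by (intro generate_incl) auto
  ultimately show ?thesis using assms by (auto simp: gen_pair_def)
qed

lemma gen_pair_commute: "gen_pair x y \<longleftrightarrow> gen_pair y x"
  by (auto simp: gen_pair_def insert_commute)

lemma gen_pair_inv: "gen_pair x y \<Longrightarrow> gen_pair (inv x) y"
  using generate.inv[of "inv x" "{inv x, y}" G]
  by (auto intro: gen_pair_transfer[of x y] generate.incl simp: gen_pair_closed)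

text \<open>A Nielsen move. Together with \<open>gen_pair_commute\<close> and
  \<open>gen_pair_inv\<close> it produces the further generating pairs on which the relations are
  tested.\<close>

lemma gen_pair_mult:
  assumes "gen_pair x y"
  shows "gen_pair x (y \<otimes> x)"
proof (rule gen_pair_transfer[OF assms])
  have xy: "x \<in> carrier G" "y \<in> carrier G"
    using assms by (auto simp: gen_pair_closed)
  then show "x \<in> carrier G" "y \<otimes> x \<in> carrier G" by auto
  show "x \<in> generate G {x, y \<otimes> x}" by (auto intro: generate.incl)
  have "(y \<otimes> x) \<otimes> inv x \<in> generate G {x, y \<otimes> x}"
    by (intro generate.eng generate.incl generate.inv) auto
  with xy show "y \<in> generate G {x, y \<otimes> x}" by (simp add: m_assoc)
qed

end

section \<open>Conjugation acting by squaring\<close>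

context group
begin

lemma inv_cancel_left:
  assumes "x \<in> carrier G" "y \<in> carrier G"
  shows "x \<otimes> (inv x \<otimes> y) = y" "inv x \<otimes> (x \<otimes> y) = y"
  using assms by (simp_all flip: m_assoc)

text \<open>The hypothesis says that conjugation by \<open>x\<close> squares \<open>y\<close>, as in
  the Baumslag-Solitar group BS(1,2). Hence conjugation by \<open>x^i\<close> multiplies exponents
  of \<open>y\<close> by \<open>2^i\<close>.\<close>

lemma conj_square_pow:
  assumes [simp]: "x \<in> carrier G" "y \<in> carrier G" and rel: "x \<otimes> y = y \<otimes> y \<otimes> x"
  shows "x [^] (i::nat) \<otimes> y [^] (j::nat) = y [^] (j * 2 ^ i) \<otimes> x [^] i"
proof (induction i arbitrary: j)
  case 0
  show ?case by simp
next
  case (Suc i)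
  have step: "x \<otimes> y [^] j = y [^] (2 * j) \<otimes> x" for j :: nat
  proof (induction j)
    case (Suc j)
    have "x \<otimes> y [^] Suc j = y [^] (2 * j) \<otimes> (x \<otimes> y)"
      using Suc by (simp flip: m_assoc)
    also have "\<dots> = y [^] (2 * Suc j) \<otimes> x"
      by (simp add: rel m_assoc)
    finally show ?case .
  qed simp
  have "x [^] Suc i \<otimes> y [^] j = x [^] i \<otimes> (x \<otimes> y [^] j)"
    by (simp add: m_assoc)
  also have "\<dots> = x [^] i \<otimes> y [^] (2 * j) \<otimes> x"
    by (simp add: step m_assoc)
  also have "\<dots> = y [^] (j * 2 ^ Suc i) \<otimes> x [^] Suc i"
    by (simp add: Suc.IH m_assoc mult_ac)
  finally show ?case .
qed

text \<open>The elements \<open>y^a x^i\<close> multiply like the affine maps t -> 2^i t + a, so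
  every positive word in \<open>x\<close> and \<open>y\<close> has such a form.\<close>

lemma conj_square_mult:
  assumes [simp]: "x \<in> carrier G" "y \<in> carrier G" and rel: "x \<otimes> y = y \<otimes> y \<otimes> x"
  shows "(y [^] (a::nat) \<otimes> x [^] (i::nat)) \<otimes> (y [^] (c::nat) \<otimes> x [^] (j::nat)) =
    y [^] (a + c * 2 ^ i) \<otimes> x [^] (i + j)"
proof -
  have "(y [^] a \<otimes> x [^] i) \<otimes> (y [^] c \<otimes> x [^] j) = y [^] a \<otimes> (x [^] i \<otimes> y [^] c) \<otimes> x [^] j"
    by (simp add: m_assoc)
  then show ?thesis
    by (simp add: conj_square_pow[OF assms] m_assoc flip: nat_pow_mult)
qed

text \<open>Cancelling leaves \<open>y^m x^k = 1\<close>. Then \<open>y^m\<close> is the inverse of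
  \<open>x^k\<close> and commutes with \<open>x\<close>; but conjugation by \<open>x\<close> also
  squares it, so \<open>y^m = x^k = 1\<close>. Now conjugation by \<open>x^k\<close> is trivial,
  whence \<open>y = y^(2^k)\<close>, and the order of \<open>y\<close> divides the coprime numbers
  \<open>m\<close> and \<open>2^k - 1\<close>.\<close>

lemma conj_square_trivial:
  fixes c m k j :: nat
  assumes [simp]: "x \<in> carrier G" "y \<in> carrier G" and rel: "x \<otimes> y = y \<otimes> y \<otimes> x"
    and eq: "y [^] (c + m) \<otimes> x [^] (k + j) = y [^] c \<otimes> x [^] j"
    and "coprime m (2 ^ k - 1)"
  shows "y = \<one>"
proof -
  have "y [^] c \<otimes> (y [^] m \<otimes> x [^] k) \<otimes> x [^] j = y [^] c \<otimes> \<one> \<otimes> x [^] j"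
    using eq by (simp add: m_assoc nat_pow_mult[of y c m, symmetric] nat_pow_mult[of x k j, symmetric])
  then have 1: "y [^] m \<otimes> x [^] k = \<one>"
    by simp
  then have 2: "x [^] k \<otimes> y [^] m = \<one>"
    by (rule inv_comm) auto
  have "x \<otimes> y [^] m = (y [^] m \<otimes> x [^] k) \<otimes> (x \<otimes> y [^] m)" using 1 by simp
  also have "\<dots> = y [^] m \<otimes> x \<otimes> (x [^] k \<otimes> y [^] m)"
    by (metis assms(1,2) m_assoc m_closed nat_pow_Suc nat_pow_Suc2 nat_pow_closed)
  also have "\<dots> = y [^] m \<otimes> x" using 2 by simp
  finally have "y [^] (m + m) \<otimes> x = y [^] m \<otimes> x"
    using conj_square_pow[OF assms(1,2) rel, of 1 m] by (simp add: mult_2_right)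
  then have ym: "y [^] m = \<one>" by (simp flip: nat_pow_mult)
  with 1 have xk: "x [^] k = \<one>" by simp
  then have "y [^] (2 ^ k :: nat) = y"
    using conj_square_pow[OF assms(1,2) rel, of k 1] by simp
  moreover obtain n where n: "(2::nat) ^ k = Suc n"
    by (metis gr0_implies_Suc zero_less_power zero_less_numeral)
  ultimately have "y [^] (2 ^ k - 1 :: nat) = \<one>" by simp
  with ym have "ord y dvd m" "ord y dvd 2 ^ k - 1"
    by (simp_all add: pow_eq_id)
  with \<open>coprime m (2 ^ k - 1)\<close> have "ord y = 1"
    by (meson coprime_common_divisor_nat)
  then show ?thesis using pow_eq_id[of y "Suc 0"] by simp
qed

end

section \<open>Relations between the elements of a generating pair\<close>

locale piecewise_excluding_group = group +
  assumes noncomm: "\<not> comm_group G"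
    and excluding: "\<And>A. finite A \<Longrightarrow> symmetric_generating_set G A \<Longrightarrow> piecewise_excluding A (Geo G A)"
begin

lemma gen_pair_noncommuting:
  assumes "gen_pair x y" shows "x \<otimes> y \<noteq> y \<otimes> x"
proof
  assume "x \<otimes> y = y \<otimes> x"
  then have "comm_group G"
    using assms by (intro comm_group_generateI[of "{x, y}"]) (auto simp: gen_pair_def)
  with noncomm show False ..
qed

text \<open>The disjuncts are the lengths 0, 1 and 2 of a word \<open>v\<close> that shortens
  \<open>x y x^-1\<close>, with the factor \<open>x^-1\<close> moved to the other side.\<close>

lemma conjugate_short:
  assumes "gen_pair x y"
  defines "A \<equiv> {x, inv x, y, inv y}"
  shows "x \<otimes> y = x \<or> (\<exists>a\<in>A. x \<otimes> y = a \<otimes> x) \<or> (\<exists>a\<in>A. \<exists>b\<in>A. x \<otimes> y = a \<otimes> b \<otimes> x)"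
proof -
  note [simp] = gen_pair_closed[OF assms(1)]
  have A: "A \<subseteq> carrier G" by (auto simp: A_def)
  have "generate G {x, y} \<subseteq> generate G A"
    by (rule mono_generate) (auto simp: A_def)
  with generate_incl[OF A] assms(1) have "generate G A = carrier G"
    by (auto simp: gen_pair_def)
  with A have "symmetric_generating_set G A"
    by (auto simp: symmetric_generating_set_def A_def)
  then obtain F where F: "w \<in> Geo G A \<longleftrightarrow> \<not> (\<exists>f\<in>F. subseq f w)" if "w \<in> lists A" for w
    using excluding[of A] by (auto simp: piecewise_excluding_def A_def)
  let ?w = "[x, y, inv x]"
  have "[x, inv x] \<notin> Geo G A"
    unfolding Geo_iff[OF A] by (auto intro!: bexI[of _ "[]"])
  then obtain f where "f \<in> F" "subseq f [x, inv x]"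
    using F[of "[x, inv x]"] by (auto simp: A_def)
  then have "f \<in> F" "subseq f ?w"
    by (auto intro: subseq_order.trans[of _ "[x, inv x]"])
  then have "?w \<notin> Geo G A" using F[of ?w] by (auto simp: A_def)
  then obtain v where v: "v \<in> lists A" "length v < 3" "foldr (\<otimes>) v \<one> = foldr (\<otimes>) ?w \<one>"
    unfolding Geo_iff[OF A] by (force simp: A_def)
  have eq: "x \<otimes> y = foldr (\<otimes>) v \<one> \<otimes> x" using v(3) by (simp add: m_assoc)
  from v(2) consider "v = []" | a where "v = [a]" | a b where "v = [a, b]"
    by (cases v; cases "tl v"; cases "tl (tl v)") auto
  then show ?thesis
    using v(1) eq A by cases (auto simp: subset_iff m_assoc)
qed

text \<open>A check of all letters \<open>a\<close>, \<open>b\<close> in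
  \<open>conjugate_short\<close>: every choice outside the seven listed relations forces
  \<open>x\<close> and \<open>y\<close> to commute.\<close>

lemma conjugate_cases:
  assumes P: "gen_pair x y"
  obtains "y \<otimes> x \<otimes> y = x" | "y \<otimes> x \<otimes> y = x \<otimes> x" | "y \<otimes> x \<otimes> x \<otimes> y = x"
    | "y \<otimes> y \<otimes> x \<otimes> y = x" | "x \<otimes> y = y \<otimes> y \<otimes> x"
    | "y \<otimes> x = x \<otimes> x \<otimes> y" | "x \<otimes> y = y \<otimes> x \<otimes> x"
proof -
  note xy [simp] = gen_pair_closed[OF P]
  note N = gen_pair_noncommuting[OF P]
  \<comment> \<open>Each of the negated equations would make one generator a power of the
    other.\<close>
  have N': "x \<noteq> \<one>" "y \<noteq> \<one>" "x \<noteq> y" "y \<noteq> x \<otimes> x" "x \<noteq> y \<otimes> y" "x \<otimes> y \<noteq> \<one>"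
    "x \<otimes> (x \<otimes> y) \<noteq> \<one>" "y \<otimes> (y \<otimes> x) \<noteq> \<one>" "y \<otimes> (x \<otimes> y) \<noteq> \<one>"
    using N by (auto simp: m_assoc) (metis N inv_closed inv_equality inv_mult_group m_assoc m_closed r_inv xy)+
  note [simp] = this N'[symmetric]
  from conjugate_short[OF P] show thesis
  proof (elim disjE bexE)
    fix a assume a: "a \<in> {x, inv x, y, inv y}" and eq: "x \<otimes> y = a \<otimes> x"
    then have "a = inv y"
      using N by (auto simp: m_assoc inv_solve_left)
    then have "y \<otimes> x \<otimes> y = x"
      using eq by (simp add: m_assoc inv_cancel_left)
    then show thesis by (rule that)
  next
    fix a b assume a: "a \<in> {x, inv x, y, inv y}" and b: "b \<in> {x, inv x, y, inv y}"
      and eq: "x \<otimes> y = a \<otimes> b \<otimes> x"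
    then have [simp]: "a \<in> carrier G" "b \<in> carrier G" by auto
    from a show thesis
    proof (elim insertE emptyE)
      assume "a = x"
      with eq have *: "y = b \<otimes> x" by (simp add: m_assoc)
      from b consider "b = x" | "b = inv x" | "b = y" | "b = inv y" by blast
      then show thesis
      proof cases
        case 1
        then show thesis using * N'(4) by simp
      next
        case 2
        then show thesis using * N'(2) by simp
      next
        case 3
        then have "y \<otimes> x = y" using * by metis
        then show thesis using N'(1) by simp
      next
        case 4
        then have "inv y \<otimes> x = y" using * by metis
        then show thesis using N'(5) by (simp add: inv_solve_left')
      qed
    next
      assume "a = inv x"
      with eq have *: "x \<otimes> (x \<otimes> y) = b \<otimes> x" by (simp add: m_assoc inv_cancel_left)
      from b show thesis
      proof (elim insertE emptyE)
        assume "b = inv y"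
        with * have "y \<otimes> x \<otimes> x \<otimes> y = x" by (simp add: m_assoc inv_cancel_left)
        then show thesis by (rule that)
      qed (use * N N' that in \<open>auto simp: m_assoc\<close>)
    next
      assume "a = y"
      with eq have "x \<otimes> y = y \<otimes> (b \<otimes> x)" by (simp add: m_assoc)
      with b show thesis using N that by (auto simp: m_assoc inv_cancel_left)
    next
      assume "a = inv y"
      with eq have *: "y \<otimes> (x \<otimes> y) = b \<otimes> x" by (simp add: m_assoc inv_cancel_left)
      from b show thesis
      proof (elim insertE emptyE)
        assume "b = inv y"
        with * have "y \<otimes> y \<otimes> x \<otimes> y = x" by (simp add: m_assoc inv_cancel_left)
        then show thesis by (rule that)
      qed (use * N N' that in \<open>auto simp: m_assoc\<close>)
    qed
  qed simp
qed

text \<open>All seven alternatives consist of positive words, so for the pair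
  \<open>(x, y x)\<close> each becomes an equation between two normal forms. Six of them fit
  \<open>conj_square_trivial\<close>; the coprimality conditions with modulus above 1 are 5 against
  3, and 9 and 11 against 7.\<close>

lemma gen_pair_not_conj_square:
  assumes P: "gen_pair x y" shows "x \<otimes> y \<noteq> y \<otimes> y \<otimes> x"
proof
  assume rel: "x \<otimes> y = y \<otimes> y \<otimes> x"
  note xy [simp] = gen_pair_closed[OF P]
  define W where "W a i = y [^] a \<otimes> x [^] i" for a i :: nat
  have mult: "W a i \<otimes> W c j = W (a + c * 2 ^ i) (i + j)" for a i c j
    unfolding W_def by (rule conj_square_mult[OF xy rel])
  have triv: False if "W (c + m) (k + j) = W c j" "coprime m (2 ^ k - 1)" for c m k j
  proof -
    have "y = \<one>" using that by (intro conj_square_trivial[OF xy rel, of c m k j]) (simp_all add: W_def)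
    then show False using gen_pair_noncommuting[OF P] by simp
  qed
  \<comment> \<open>the pair \<open>(x, y x)\<close>, written in the normal form \<open>y\<^sup>a x\<^sup>i\<close>\<close>
  have "gen_pair (W 0 1) (W 1 1)" using gen_pair_mult[OF P] by (simp add: W_def)
  then show False
  proof (cases rule: conjugate_cases)
    case 1
    then show ?thesis using triv[of 0 5 2 1] by (simp add: mult coprime_iff_gcd_eq_1 gcd_non_0_nat del: One_nat_def)
  next
    case 2
    then show ?thesis using triv[of 0 5 1 2] by (simp add: mult del: One_nat_def)
  next
    case 3
    then show ?thesis using triv[of 0 9 3 1] by (simp add: mult coprime_iff_gcd_eq_1 gcd_non_0_nat del: One_nat_def)
  next
    case 4
    then show ?thesis using triv[of 0 11 3 1] by (simp add: mult coprime_iff_gcd_eq_1 gcd_non_0_nat del: One_nat_def)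
  next
    case 5
    then show ?thesis using triv[of 2 1 1 2] by (simp add: mult numeral_2_eq_2[symmetric] del: One_nat_def)
  next
    case 6
    then show ?thesis using triv[of 1 3 1 2] by (simp add: mult del: One_nat_def)
  next
    case 7
    \<comment> \<open>Here the exponent of \<open>y\<close> falls while that of \<open>x\<close>
      rises, so \<open>triv\<close> does not fit; plain cancellation gives
      \<open>y = x\<close>.\<close>
    then have "W 2 2 = W 1 3"
      by (simp add: mult numeral_2_eq_2[symmetric] del: One_nat_def)
    then have "y = x" by (simp add: W_def numeral_eq_Suc m_assoc)
    then show ?thesis using gen_pair_noncommuting[OF P] by simp
  qed
qed

text \<open>The last three alternatives of \<open>conjugate_cases\<close> say that conjugation by
  one generator or its inverse squares the other. They are excluded by
  \<open>gen_pair_not_conj_square\<close> for \<open>(x, y)\<close>, \<open>(y, x)\<close> and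
  \<open>(y^-1, x)\<close>.\<close>

lemma conjugate_reduced_cases:
  assumes P: "gen_pair x y"
  obtains "y \<otimes> x \<otimes> y = x" | "y \<otimes> x \<otimes> y = x \<otimes> x" | "y \<otimes> x \<otimes> x \<otimes> y = x" | "y \<otimes> y \<otimes> x \<otimes> y = x"
proof -
  note xy [simp] = gen_pair_closed[OF P]
  have P': "gen_pair (inv y) x" "gen_pair y x"
    using P gen_pair_inv gen_pair_commute by blast+
  have *: "x \<otimes> y \<noteq> y \<otimes> x \<otimes> x"
  proof
    assume "x \<otimes> y = y \<otimes> x \<otimes> x"
    then have "x \<otimes> x = inv y \<otimes> (x \<otimes> y)"
      by (simp add: m_assoc inv_cancel_left)
    then have "x \<otimes> x \<otimes> inv y = inv y \<otimes> x" by (simp add: m_assoc)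
    then show False using gen_pair_not_conj_square[OF P'(1)] by simp
  qed
  from P show thesis
    by (rule conjugate_cases)
      (use that * gen_pair_not_conj_square[OF P] gen_pair_not_conj_square[OF P'(2)] in auto)
qed

text \<open>The excluded relation is \<open>x y x^-1 = y^-2\<close>. Each alternative for
  \<open>(x^-1, y)\<close> is inverted to remove \<open>x^-1\<close>; combined with the relation it
  cancels to \<open>y = 1\<close>, \<open>y = x\<close>, \<open>y x = 1\<close> or
  \<open>x y = y x\<close>.\<close>

lemma gen_pair_not_conj_inv_square:
  assumes P: "gen_pair x y" shows "y \<otimes> y \<otimes> x \<otimes> y \<noteq> x"
proof
  assume rel: "y \<otimes> y \<otimes> x \<otimes> y = x"
  note xy [simp] = gen_pair_closed[OF P]
  note N = gen_pair_noncommuting[OF P]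
  have inv_eqI: "inv u = inv v \<Longrightarrow> u = v" if "u \<in> carrier G" "v \<in> carrier G" for u v
    using that inv_inv by metis
  from gen_pair_inv[OF P] show False
  proof (cases rule: conjugate_reduced_cases)
    case 1
    then have "inv (inv y \<otimes> x \<otimes> inv y) = inv x"
      by (simp add: inv_mult_group m_assoc)
    then have "inv y \<otimes> x \<otimes> inv y = x" by (rule inv_eqI[rotated 2]) auto
    then have "y \<otimes> x \<otimes> y = x"
      by (metis inv_closed inv_inv inv_solve_left inv_solve_right m_assoc m_closed xy)
    then show ?thesis using rel N by (simp add: m_assoc)
  next
    case 2
    then have "inv (inv y \<otimes> x \<otimes> inv y) = inv (x \<otimes> x)"
      by (simp add: inv_mult_group m_assoc)
    then have "inv y \<otimes> x \<otimes> inv y = x \<otimes> x" by (rule inv_eqI[rotated 2]) auto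
    then have eq: "x = y \<otimes> x \<otimes> x \<otimes> y"
      by (metis inv_closed inv_inv inv_solve_left inv_solve_right m_assoc m_closed xy)
    have "y \<otimes> y \<otimes> x \<otimes> y = y \<otimes> x \<otimes> x \<otimes> y" using rel eq by simp
    then show ?thesis using N by (simp add: m_assoc)
  next
    case 3
    then have "inv (inv y \<otimes> x \<otimes> x \<otimes> inv y) = inv x"
      by (simp add: inv_mult_group m_assoc)
    then have "inv y \<otimes> x \<otimes> x \<otimes> inv y = x" by (rule inv_eqI[rotated 2]) auto
    then have eq: "x \<otimes> x = y \<otimes> x \<otimes> y"
      by (metis inv_closed inv_inv inv_solve_left inv_solve_right m_assoc m_closed xy)
    have "y \<otimes> (x \<otimes> x) = x" using rel by (simp add: eq m_assoc)
    then have "y \<otimes> x = \<one>" by (simp flip: m_assoc)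
    then show ?thesis using N inv_comm by force
  next
    case 4
    then have "inv (inv y \<otimes> x \<otimes> inv y \<otimes> inv y) = inv x"
      by (simp add: inv_mult_group m_assoc)
    then have "inv y \<otimes> x \<otimes> inv y \<otimes> inv y = x" by (rule inv_eqI[rotated 2]) auto
    then have "x = y \<otimes> x \<otimes> y \<otimes> y"
      by (metis inv_closed inv_inv inv_solve_left inv_solve_right m_assoc m_closed xy)
    then have "y \<otimes> y \<otimes> x \<otimes> y = y \<otimes> x \<otimes> y \<otimes> y" using rel by simp
    then have "(y \<otimes> (y \<otimes> x)) \<otimes> y = (y \<otimes> (x \<otimes> y)) \<otimes> y" by (simp only: m_assoc xy m_closed)
    then have "y \<otimes> (y \<otimes> x) = y \<otimes> (x \<otimes> y)" by (subst (asm) right_cancel) simp_all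
    then show ?thesis using N by simp
  qed
qed

text \<open>This is the relation of the trefoil knot group, where \<open>x^3 = z^2\<close> is
  central. The alternatives for \<open>(x z, z)\<close> either make \<open>x^2\<close> commute with
  \<open>z\<close>, or give the braid relation, or were excluded before.\<close>

lemma gen_pair_cube_neq_square:
  assumes P: "gen_pair x z" shows "x \<otimes> x \<otimes> x \<noteq> z \<otimes> z"
proof
  assume rel: "x \<otimes> x \<otimes> x = z \<otimes> z"
  note xz [simp] = gen_pair_closed[OF P]
  note N = gen_pair_noncommuting[OF P]
  \<comment> \<open>The element \<open>x^3 = z^2\<close> commutes with \<open>z\<close>; if
    \<open>x^2\<close> did too, so would \<open>x\<close>.\<close>
  have sq: "x \<otimes> x \<otimes> z \<noteq> z \<otimes> (x \<otimes> x)"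
  proof
    assume 2: "x \<otimes> x \<otimes> z = z \<otimes> (x \<otimes> x)"
    have "x \<otimes> x \<otimes> (x \<otimes> z) = z \<otimes> z \<otimes> z" using rel by (simp flip: m_assoc)
    also have "\<dots> = z \<otimes> (x \<otimes> x) \<otimes> x" using rel by (simp add: m_assoc)
    also have "\<dots> = x \<otimes> x \<otimes> z \<otimes> x" by (simp only: 2)
    finally show False using N by (simp add: m_assoc)
  qed
  have "gen_pair z (x \<otimes> z)"
    using P gen_pair_mult gen_pair_commute by blast
  then have "gen_pair (x \<otimes> z) z" by (simp add: gen_pair_commute)
  then show False
  proof (cases rule: conjugate_reduced_cases)
    case 1
    then have zxz: "z \<otimes> (x \<otimes> z) = x" by (simp flip: m_assoc)
    have "x \<otimes> x \<otimes> z = z \<otimes> (x \<otimes> z) \<otimes> x \<otimes> z" using zxz by simp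
    also have "\<dots> = z \<otimes> (x \<otimes> (z \<otimes> (x \<otimes> z)))" by (simp add: m_assoc)
    also have "\<dots> = z \<otimes> (x \<otimes> x)" using zxz by simp
    finally show ?thesis using sq by simp
  next
    case 2
    \<comment> \<open>The braid relation reads \<open>z (x z) = (x z) x\<close>, so
      \<open>z^3 (x z) = (x z) x^3\<close>. As \<open>x^3 = z^2\<close> is central, the right side
      is \<open>z^2 (x z)\<close>, and \<open>z = 1\<close> follows.\<close>
    then have braid: "z \<otimes> (x \<otimes> z) = x \<otimes> (z \<otimes> x)" by (simp flip: m_assoc)
    have "z \<otimes> (z \<otimes> z \<otimes> (x \<otimes> z)) = z \<otimes> (z \<otimes> (z \<otimes> (x \<otimes> z)))" by (simp add: m_assoc)
    also have "\<dots> = z \<otimes> (z \<otimes> (x \<otimes> (z \<otimes> x)))" by (simp only: braid)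
    also have "\<dots> = z \<otimes> (z \<otimes> (x \<otimes> z)) \<otimes> x" by (simp add: m_assoc)
    also have "\<dots> = z \<otimes> (x \<otimes> (z \<otimes> x)) \<otimes> x" by (simp only: braid)
    also have "\<dots> = z \<otimes> (x \<otimes> z) \<otimes> (x \<otimes> x)" by (simp add: m_assoc)
    also have "\<dots> = x \<otimes> (z \<otimes> x) \<otimes> (x \<otimes> x)" by (simp only: braid)
    also have "\<dots> = x \<otimes> z \<otimes> (x \<otimes> x \<otimes> x)" by (simp add: m_assoc)
    also have "\<dots> = x \<otimes> (z \<otimes> z) \<otimes> z" by (simp add: rel) (simp add: m_assoc)
    also have "\<dots> = (x \<otimes> x \<otimes> x) \<otimes> x \<otimes> z" by (simp flip: rel) (simp add: m_assoc)
    also have "\<dots> = z \<otimes> z \<otimes> (x \<otimes> z)" by (simp add: rel) (simp add: m_assoc)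
    finally have "z = \<one>" by simp
    then show ?thesis using N by simp
  next
    case 3
    then have eq: "z \<otimes> (x \<otimes> (z \<otimes> (x \<otimes> z))) = x" by (simp flip: m_assoc)
    have "x \<otimes> x \<otimes> z \<otimes> x = z \<otimes> (x \<otimes> (z \<otimes> (x \<otimes> z))) \<otimes> x \<otimes> z \<otimes> x" by (simp add: eq)
    also have "\<dots> = z \<otimes> x \<otimes> (z \<otimes> (x \<otimes> (z \<otimes> (x \<otimes> z)))) \<otimes> x" by (simp add: m_assoc)
    also have "\<dots> = z \<otimes> (x \<otimes> x) \<otimes> x" by (simp add: eq m_assoc)
    finally show ?thesis using sq by simp
  next
    case 4
    with gen_pair_not_conj_inv_square[OF \<open>gen_pair (x \<otimes> z) z\<close>] show ?thesis ..
  qed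
qed

text \<open>The second and third alternatives amount to \<open>x^3 = (y x)^2\<close> and
  \<open>x^3 = (y x x)^2\<close>, a cube equal to a square in the generating pairs
  \<open>(x, y x)\<close> and \<open>(x, y x x)\<close>.\<close>

lemma gen_pair_quaternion:
  assumes P: "gen_pair x y" shows "y \<otimes> x \<otimes> y = x"
proof -
  note xy [simp] = gen_pair_closed[OF P]
  have yx: "gen_pair x (y \<otimes> x)" using P by (rule gen_pair_mult)
  from P show ?thesis
  proof (cases rule: conjugate_reduced_cases)
    case 2
    then have "(y \<otimes> x \<otimes> y) \<otimes> x = x \<otimes> x \<otimes> x" by simp
    then have "x \<otimes> x \<otimes> x = (y \<otimes> x) \<otimes> (y \<otimes> x)" by (simp add: m_assoc)
    with gen_pair_cube_neq_square[OF yx] show ?thesis ..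
  next
    case 3
    then have "x \<otimes> x \<otimes> x = (y \<otimes> x \<otimes> x) \<otimes> (y \<otimes> x \<otimes> x)" by (simp flip: m_assoc)
    with gen_pair_cube_neq_square[OF gen_pair_mult[OF yx]] show ?thesis ..
  next
    case 4
    with gen_pair_not_conj_inv_square[OF P] show ?thesis ..
  qed
qed

end

section \<open>The quaternion relations\<close>

text \<open>A list rather than a set, so that \<open>distinct\<close> can express that the eight
  products differ.\<close>

definition quaternion_list :: "('a, 'b) monoid_scheme \<Rightarrow> 'a \<Rightarrow> 'a \<Rightarrow> 'a list" where
  "quaternion_list G x y = (let x2 = x \<otimes>\<^bsub>G\<^esub> x; x3 = x \<otimes>\<^bsub>G\<^esub> x2 in
     [\<one>\<^bsub>G\<^esub>, x, x2, x3, y, x \<otimes>\<^bsub>G\<^esub> y, x2 \<otimes>\<^bsub>G\<^esub> y, x3 \<otimes>\<^bsub>G\<^esub> y])"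

locale quaternion_pair = group +
  fixes x y
  assumes closed [simp]: "x \<in> carrier G" "y \<in> carrier G"
    and yxy: "y \<otimes> x \<otimes> y = x" and xyx: "x \<otimes> y \<otimes> x = y"
begin

lemma square_eq: "y \<otimes> y = x \<otimes> x"
proof -
  have "y \<otimes> y = y \<otimes> (x \<otimes> y \<otimes> x)" by (simp only: xyx)
  also have "\<dots> = y \<otimes> x \<otimes> y \<otimes> x" by (simp add: m_assoc)
  finally show ?thesis by (simp only: yxy)
qed

lemma fourth_power: "x \<otimes> (x \<otimes> (x \<otimes> x)) = \<one>"
proof -
  have "x = y \<otimes> (y \<otimes> x \<otimes> y) \<otimes> y" by (simp only: yxy)
  also have "\<dots> = (y \<otimes> y) \<otimes> x \<otimes> (y \<otimes> y)" by (simp add: m_assoc)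
  also have "\<dots> = x \<otimes> (x \<otimes> (x \<otimes> x)) \<otimes> x" by (simp add: square_eq) (simp add: m_assoc)
  finally show ?thesis by simp
qed

lemma mult_swap: "y \<otimes> x = x \<otimes> (x \<otimes> (x \<otimes> y))"
proof -
  have "x \<otimes> (x \<otimes> (x \<otimes> y)) = x \<otimes> (x \<otimes> (x \<otimes> (x \<otimes> y \<otimes> x)))" by (simp only: xyx)
  also have "\<dots> = (x \<otimes> (x \<otimes> (x \<otimes> x))) \<otimes> (y \<otimes> x)" by (simp add: m_assoc)
  finally show ?thesis by (simp add: fourth_power)
qed

text \<open>The rewrite system bringing products to the normal form \<open>x\<^sup>a y\<^sup>b\<close> with \<open>a < 4\<close>, \<open>b < 2\<close>.\<close>

lemma normalize:
  "y \<otimes> x = x \<otimes> (x \<otimes> (x \<otimes> y))" "y \<otimes> y = x \<otimes> x" "x \<otimes> (x \<otimes> (x \<otimes> x)) = \<one>"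
  "w \<in> carrier G \<Longrightarrow> y \<otimes> (x \<otimes> w) = x \<otimes> (x \<otimes> (x \<otimes> (y \<otimes> w)))"
  "w \<in> carrier G \<Longrightarrow> y \<otimes> (y \<otimes> w) = x \<otimes> (x \<otimes> w)"
  "w \<in> carrier G \<Longrightarrow> x \<otimes> (x \<otimes> (x \<otimes> (x \<otimes> w))) = w"
proof -
  show 1: "y \<otimes> x = x \<otimes> (x \<otimes> (x \<otimes> y))" by (rule mult_swap)
  show 2: "y \<otimes> y = x \<otimes> x" by (rule square_eq)
  show 3: "x \<otimes> (x \<otimes> (x \<otimes> x)) = \<one>" by (rule fourth_power)
  assume [simp]: "w \<in> carrier G"
  show "y \<otimes> (x \<otimes> w) = x \<otimes> (x \<otimes> (x \<otimes> (y \<otimes> w)))"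
    using arg_cong[OF 1, of "\<lambda>g. g \<otimes> w"] by (simp add: m_assoc)
  show "y \<otimes> (y \<otimes> w) = x \<otimes> (x \<otimes> w)"
    using arg_cong[OF 2, of "\<lambda>g. g \<otimes> w"] by (simp add: m_assoc)
  show "x \<otimes> (x \<otimes> (x \<otimes> (x \<otimes> w))) = w"
    using arg_cong[OF 3, of "\<lambda>g. g \<otimes> w"] by (simp add: m_assoc)
qed

lemma set_quaternion_list:
  "set (quaternion_list G x y) = {\<one>, x, x \<otimes> x, x \<otimes> (x \<otimes> x), y, x \<otimes> y, x \<otimes> (x \<otimes> y), x \<otimes> (x \<otimes> (x \<otimes> y))}"
  by (simp add: quaternion_list_def Let_def m_assoc)

lemma subgroup_quaternion: "subgroup (set (quaternion_list G x y)) G"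
proof (rule subgroupI)
  show "set (quaternion_list G x y) \<subseteq> carrier G" "set (quaternion_list G x y) \<noteq> {}"
    by (auto simp: set_quaternion_list)
  show "g \<otimes> h \<in> set (quaternion_list G x y)"
    if "g \<in> set (quaternion_list G x y)" "h \<in> set (quaternion_list G x y)" for g h
    using that unfolding set_quaternion_list
    by (elim insertE emptyE) (simp_all add: m_assoc normalize)
  show "inv g \<in> set (quaternion_list G x y)" if "g \<in> set (quaternion_list G x y)" for g
  proof -
    have "\<exists>h \<in> set (quaternion_list G x y). h \<otimes> g = \<one>"
      using that unfolding set_quaternion_list
      by (elim insertE emptyE) (simp_all add: m_assoc normalize)
    then show ?thesis
      using inv_equality that by (auto simp: set_quaternion_list)
  qed
qed

text \<open>Hence any two noncommuting entries form a \<open>quaternion_pair\<close> themselves, so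
  that no pair of generators is special.\<close>

lemma quaternion_commute_or:
  assumes "g \<in> set (quaternion_list G x y)" "h \<in> set (quaternion_list G x y)"
  shows "g \<otimes> h = h \<otimes> g \<or> h \<otimes> g \<otimes> h = g"
  using assms unfolding set_quaternion_list
  by (elim insertE emptyE) (simp_all add: m_assoc normalize)

text \<open>A coincidence would make \<open>x\<close>, \<open>x^2\<close> or \<open>x^3\<close>
  trivial or \<open>y\<close> a power of \<open>x\<close>. If \<open>x^2 = 1\<close>, then
  \<open>y x = x^3 y\<close> becomes commutation; \<open>x^3 = 1\<close> reduces to
  \<open>x = 1\<close> by the fourth power.\<close>

lemma distinct_quaternion_list:
  assumes N: "x \<otimes> y \<noteq> y \<otimes> x"
  shows "distinct (quaternion_list G x y)"
proof -
  have 2: "x \<otimes> x \<noteq> \<one>"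
  proof
    assume "x \<otimes> x = \<one>"
    then have "y \<otimes> x = x \<otimes> y" by (simp add: mult_swap flip: m_assoc)
    with N show False by simp
  qed
  have "x \<noteq> \<one>" "y \<noteq> \<one>" "y \<noteq> x" "y \<noteq> x \<otimes> x" "y \<noteq> x \<otimes> (x \<otimes> x)"
    using N by (auto simp: m_assoc)
  moreover have 3: "x \<otimes> (x \<otimes> x) \<noteq> \<one>"
    using fourth_power \<open>x \<noteq> \<one>\<close> by auto
  moreover have "x \<otimes> (x \<otimes> (x \<otimes> y)) \<noteq> \<one>" 
    using normalize(6)[of y] \<open>y \<noteq> x\<close> by auto
  moreover have "x \<otimes> (x \<otimes> y) \<noteq> \<one>"
    using normalize(6)[of y] \<open>y \<noteq> x \<otimes> x\<close> by auto
  moreover have "x \<otimes> y \<noteq> \<one>"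
    using normalize(6)[of y] \<open>y \<noteq> x \<otimes> (x \<otimes> x)\<close> by auto
  moreover have "y \<noteq> x \<otimes> (x \<otimes> y)" "y \<noteq> x \<otimes> (x \<otimes> (x \<otimes> y))"
    using 2 3 by (simp_all flip: m_assoc)
  ultimately show ?thesis
    using 2 by (auto simp: quaternion_list_def Let_def m_assoc dest: sym)
qed

end

section \<open>The presentation of the quaternion group\<close>

context group
begin

lemma foldr_mult_append:
  "u \<in> lists (carrier G) \<Longrightarrow> v \<in> lists (carrier G) \<Longrightarrow>
    foldr (\<otimes>) (u @ v) \<one> = foldr (\<otimes>) u \<one> \<otimes> foldr (\<otimes>) v \<one>"
  by (induction u) (auto simp: m_assoc word_closed)

text \<open>Von Dyck's theorem: an assignment of the generators that kills the relators extends to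
  the presented group.\<close>

lemma presented_group_hom:
  fixes val :: "'g \<Rightarrow> 'a"
  defines "ev \<equiv> \<lambda>u. foldr (\<otimes>) (map (\<lambda>(g, b). if b then val g else inv val g) u) \<one>"
  assumes val [simp]: "\<And>g. val g \<in> carrier G" and rel: "\<And>r. r \<in> R \<Longrightarrow> ev r = \<one>"
  shows "\<exists>\<phi> \<in> hom (presented_group R) G. \<forall>u. \<phi> (Collect (pres_eq R u)) = ev u"
proof -
  have letters: "map (\<lambda>(g, b). if b then val g else inv val g) u \<in> lists (carrier G)" for u
    by (auto simp: subset_iff)
  have closed [simp]: "ev u \<in> carrier G" for u
    unfolding ev_def by (rule word_closed[OF letters])
  have append: "ev (u @ v) = ev u \<otimes> ev v" for u v
    unfolding ev_def by (simp only: map_append foldr_mult_append[OF letters letters])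
  have eq: "ev u = ev v" if "pres_eq R u v" for u v
    using that
  proof induction
    case (cancel u g b v)
    have "ev [(g, b), (g, \<not> b)] = \<one>" by (simp add: ev_def)
    then show ?case by (simp only: append) simp
  next
    case (relator r u v)
    then show ?case by (simp add: append rel)
  qed auto
  \<comment> \<open>The value is read off a chosen representative of the class; \<open>eq\<close>
    makes the choice irrelevant.\<close>
  define \<phi> where "\<phi> X = ev (SOME u. u \<in> X)" for X
  have \<phi>: "\<phi> (Collect (pres_eq R u)) = ev u" for u
  proof -
    have "(SOME v. v \<in> Collect (pres_eq R u)) \<in> Collect (pres_eq R u)"
      by (rule someI[of _ u]) (simp add: pres_eq.refl)
    then show ?thesis using eq by (simp add: \<phi>_def)
  qed
  have "\<phi> \<in> hom (presented_group R) G"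
  proof (rule homI)
    fix X Y assume "X \<in> carrier (presented_group R)" "Y \<in> carrier (presented_group R)"
    then obtain u v where "X = Collect (pres_eq R u)" "Y = Collect (pres_eq R v)"
      by (auto simp: presented_group_def)
    then show "\<phi> (X \<otimes>\<^bsub>presented_group R\<^esub> Y) = \<phi> X \<otimes> \<phi> Y"
      by (simp add: pres_class_mult \<phi> append)
  qed (auto simp: presented_group_def \<phi>)
  with \<phi> show ?thesis by blast
qed

end

abbreviation Q8_letter :: "quat_gen \<Rightarrow> (quat_gen \<times> bool) list set" where
  "Q8_letter g \<equiv> Collect (pres_eq Q8_relators [(g, True)])"

text \<open>The relators give \<open>ij = k\<close>, \<open>jk = i\<close>, \<open>ki = j\<close>,
  so \<open>jij = jk = i\<close> and \<open>iji = ki = j\<close>. The list is then a subgroup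
  containing all letters and their inverses, hence all words.\<close>

lemma Q8_pair:
  shows "quaternion_pair Q8 (Q8_letter Qi) (Q8_letter Qj)"
    and "carrier Q8 = set (quaternion_list Q8 (Q8_letter Qi) (Q8_letter Qj))"
proof -
  interpret group Q8 by (rule group_Q8)
  let ?c = "\<lambda>u. Collect (pres_eq Q8_relators u)"
  let ?i = "Q8_letter Qi" and ?j = "Q8_letter Qj" and ?k = "Q8_letter Qk"
  have carr: "carrier Q8 = range ?c" and one: "\<one>\<^bsub>Q8\<^esub> = ?c []"
    by (simp_all add: Q8_def presented_group_def)
  have mult: "?c u \<otimes>\<^bsub>Q8\<^esub> ?c v = ?c (u @ v)" for u v
    by (simp add: Q8_def pres_class_mult)
  have closed [simp]: "?c u \<in> carrier Q8" for u by (simp add: carr)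
  have inv: "?c [(g, False)] = inv\<^bsub>Q8\<^esub> Q8_letter g" for g
    using pres_eq.cancel[of Q8_relators "[]" g False "[]"]
    by (intro inv_equality[symmetric]) (simp_all add: mult one pres_class_eq)
  have rel: "Q8_letter a \<otimes>\<^bsub>Q8\<^esub> Q8_letter b = Q8_letter c"
    if "[(a, True), (b, True), (c, False)] \<in> Q8_relators" for a b c
  proof -
    have "Q8_letter a \<otimes>\<^bsub>Q8\<^esub> Q8_letter b \<otimes>\<^bsub>Q8\<^esub> ?c [(c, False)] = \<one>\<^bsub>Q8\<^esub>"
      using pres_eq.relator[OF that, of "[]" "[]"] by (simp add: mult one pres_class_eq)
    then show ?thesis by (simp add: inv inv_solve_right')
  qed
  have ij: "?i \<otimes>\<^bsub>Q8\<^esub> ?j = ?k" and jk: "?j \<otimes>\<^bsub>Q8\<^esub> ?k = ?i" and ki: "?k \<otimes>\<^bsub>Q8\<^esub> ?i = ?j"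
    by (rule rel; simp add: Q8_relators_def)+
  show pair: "quaternion_pair Q8 ?i ?j"
  proof unfold_locales
    show "?j \<otimes>\<^bsub>Q8\<^esub> ?i \<otimes>\<^bsub>Q8\<^esub> ?j = ?i" by (simp only: m_assoc closed ij jk)
    show "?i \<otimes>\<^bsub>Q8\<^esub> ?j \<otimes>\<^bsub>Q8\<^esub> ?i = ?j" by (simp only: ij ki)
  qed auto
  interpret quaternion_pair Q8 ?i ?j by (rule pair)
  let ?L = "set (quaternion_list Q8 ?i ?j)"
  note L = subgroup_quaternion
  have "?i \<in> ?L" "?j \<in> ?L" "?k \<in> ?L"
    by (simp_all add: set_quaternion_list ij)
  then have "Q8_letter g \<in> ?L" for g by (cases g) simp_all
  then have letter: "?c [l] \<in> ?L" for l
    using subgroup.m_inv_closed[OF L] inv by (cases l; cases "snd l") auto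
  have "?c u \<in> ?L" for u
  proof (induction u)
    case Nil
    then show ?case using subgroup.one_closed[OF L] by (simp add: one)
  next
    case (Cons l u)
    then show ?case
      using subgroup.m_closed[OF L letter[of l] Cons] by (simp add: mult)
  qed
  with subgroup.subset[OF L] show "carrier Q8 = ?L" by (auto simp: carr)
qed

lemma card_Q8: "finite (carrier Q8)" "card (carrier Q8) \<le> 8"
  using card_length[of "quaternion_list Q8 (Q8_letter Qi) (Q8_letter Qj)"]
  by (simp_all add: Q8_pair(2) quaternion_list_def Let_def)

text \<open>Von Dyck's theorem sends \<open>i\<close>, \<open>j\<close>, \<open>k\<close> to
  \<open>x\<close>, \<open>y\<close>, \<open>x y\<close>. The map is onto because \<open>x\<close>
  and \<open>y\<close> generate, and injective by counting: \<open>Q8\<close> has at most 8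
  elements, \<open>G\<close> at least 8.\<close>

lemma (in quaternion_pair) iso_Q8:
  assumes gen: "generate G {x, y} = carrier G" and N: "x \<otimes> y \<noteq> y \<otimes> x"
  shows "G \<cong> Q8"
proof -
  define val where "val g = (case g of Qi \<Rightarrow> x | Qj \<Rightarrow> y | Qk \<Rightarrow> x \<otimes> y)" for g
  have closed_val: "val g \<in> carrier G" for g by (cases g) (simp_all add: val_def)
  have k: "y \<otimes> (x \<otimes> y) = x" "x \<otimes> (y \<otimes> x) = y"
    using yxy xyx by (simp_all add: m_assoc)
  have "\<exists>\<phi> \<in> hom (presented_group Q8_relators) G. \<forall>u. \<phi> (Collect (pres_eq Q8_relators u)) =
      foldr (\<otimes>) (map (\<lambda>(g, b). if b then val g else inv val g) u) \<one>"
    by (rule presented_group_hom[OF closed_val])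
      (auto simp: Q8_relators_def val_def fourth_power inv_mult_group m_assoc k
        simp flip: m_assoc[of y x "inv x"], 
       simp_all add: yxy xyx k flip: m_assoc)
  then obtain \<phi> where \<phi>: "\<phi> \<in> hom Q8 G" and
    ev: "\<And>u. \<phi> (Collect (pres_eq Q8_relators u)) =
      foldr (\<otimes>) (map (\<lambda>(g, b). if b then val g else inv val g) u) \<one>"
    by (auto simp: Q8_def)
  interpret \<phi>: group_hom Q8 G \<phi>
    by (intro group_hom.intro group_Q8 is_group) (simp add: group_hom_axioms_def \<phi>)
  have "\<phi> (Q8_letter Qi) = x" "\<phi> (Q8_letter Qj) = y" by (simp_all add: ev val_def)
  moreover have "Q8_letter g \<in> carrier Q8" for g
    by (simp add: Q8_def presented_group_def)
  ultimately have "{x, y} \<subseteq> \<phi> ` carrier Q8" by blast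
  from generate_subgroup_incl[OF this \<phi>.img_is_subgroup]
  have "carrier G \<subseteq> \<phi> ` carrier Q8" by (simp only: gen)
  moreover have "\<phi> ` carrier Q8 \<subseteq> carrier G" using \<phi>.hom_closed by blast
  ultimately have surj: "\<phi> ` carrier Q8 = carrier G" by blast
  then have "finite (carrier G)" using card_Q8(1) finite_imageI by metis
  have "card (carrier Q8) \<le> card (set (quaternion_list G x y))"
    using card_Q8(2) distinct_card[OF distinct_quaternion_list[OF N]]
    by (simp add: quaternion_list_def Let_def)
  also have "\<dots> \<le> card (carrier G)"
    using \<open>finite (carrier G)\<close> subgroup.subset[OF subgroup_quaternion] by (rule card_mono)
  finally have "inj_on \<phi> (carrier Q8)"
    using surj card_image_le[OF card_Q8(1), of \<phi>]
    by (intro eq_card_imp_inj_on card_Q8(1)) simp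
  with surj \<phi> have "\<phi> \<in> iso Q8 G" by (simp add: iso_def bij_betw_def)
  then show ?thesis using group.iso_sym[OF group_Q8] by (auto simp: is_iso_def)
qed

section \<open>Generating sets of the quaternion group\<close>

lemma (in group) piecewise_excluding_diameter_2:
  assumes A: "finite A" "A \<subseteq> carrier G"
    and diam: "\<And>g. g \<in> carrier G \<Longrightarrow> \<exists>v\<in>lists A. length v \<le> 2 \<and> foldr (\<otimes>) v \<one> = g"
  shows "piecewise_excluding A (Geo G A)"
proof -
  \<comment> \<open>The bound 3 is the diameter bound plus one: a longer word has a prefix of length
    3, which cannot be geodesic.\<close>
  define F where "F = {f \<in> lists A. length f \<le> 3 \<and> f \<notin> Geo G A}"
  have "finite F"
    using finite_lists_length_le[OF A(1), of 3] by (rule rev_finite_subset) (auto simp: F_def)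
  have short: "length w \<le> 2" if "w \<in> Geo G A" for w
  proof (rule ccontr)
    assume "\<not> length w \<le> 2"
    moreover have "foldr (\<otimes>) w \<one> \<in> carrier G"
      using that A(2) word_closed[of w] by (auto simp: Geo_iff)
    ultimately show False
      using diam[of "foldr (\<otimes>) w \<one>"] that unfolding Geo_iff[OF A(2)] by force
  qed
  have "w \<in> Geo G A \<longleftrightarrow> \<not> (\<exists>f\<in>F. subseq f w)" if w: "w \<in> lists A" for w
  proof (intro iffI notI)
    assume geo: "w \<in> Geo G A" and "\<exists>f\<in>F. subseq f w"
    then obtain f where f: "f \<in> F" "subseq f w" by blast
    then have "f \<noteq> w" using geo by (auto simp: F_def)
    with f(2) have less: "length f < length w"
      by (meson list_emb_length nat_less_le subseq_same_length)
    obtain v where v: "length v < length f" "foldr (\<otimes>) v \<one> = foldr (\<otimes>) f \<one>"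
      using f(1) by (auto simp: F_def Geo_iff[OF A(2)])
    \<comment> \<open>A nongeodesic proper subword of a word of length at most 2 is a single letter
      representing the identity; deleting that letter shortens \<open>w\<close>.\<close>
    with less short[OF geo] have "length f = 1 \<and> length w = 2 \<and> length v = 0" by linarith
    then obtain a b c where ws: "f = [c]" "w = [a, b]" and "v = []"
      by (auto simp: length_Suc_conv numeral_2_eq_2)
    with w A(2) have ab: "a \<in> carrier G" "b \<in> carrier G" "a \<in> A" "b \<in> A" by auto
    have "c = a \<or> c = b" using f(2) ws by (auto split: if_splits)
    with v ws \<open>v = []\<close> ab have "a = \<one> \<or> b = \<one>" by auto
    with ab obtain d where "d \<in> A" "foldr (\<otimes>) [d] \<one> = foldr (\<otimes>) w \<one>"
      by (auto simp: ws)
    then have "\<exists>v\<in>lists A. length v < length w \<and> foldr (\<otimes>) v \<one> = foldr (\<otimes>) w \<one>"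
      by (intro bexI[of _ "[d]"]) (simp_all add: ws)
    with geo show False by (simp add: Geo_iff[OF A(2)])
  next
    assume *: "\<not> (\<exists>f\<in>F. subseq f w)"
    show "w \<in> Geo G A"
    proof (rule ccontr)
      assume "w \<notin> Geo G A"
      have "take 3 w \<notin> Geo G A"
        using short[of "take 3 w"] \<open>w \<notin> Geo G A\<close> by (cases "length w \<le> 2") auto
      then have "take 3 w \<in> F"
        using w set_take_subset[of 3 w] by (auto simp: F_def)
      then show False
        using * prefix_imp_subseq[OF take_is_prefix] by blast
    qed
  qed
  moreover have "Geo G A \<subseteq> lists A" by (auto simp: Geo_iff[OF A(2)])
  moreover have "F \<subseteq> lists A" by (auto simp: F_def)
  ultimately show ?thesis
    using \<open>finite F\<close> unfolding piecewise_excluding_def by blast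
qed

lemma (in group) iso_Q8_piecewise_excluding:
  assumes iso: "G \<cong> Q8" and nc: "\<not> comm_group G"
    and A: "finite A" "symmetric_generating_set G A"
  shows "piecewise_excluding A (Geo G A)"
proof -
  obtain \<phi> where \<phi>: "\<phi> \<in> hom G Q8" "bij_betw \<phi> (carrier G) (carrier Q8)"
    using iso by (auto simp: is_iso_def iso_def)
  interpret Q: quaternion_pair Q8 "Q8_letter Qi" "Q8_letter Qj" by (rule Q8_pair(1))
  have fin: "finite (carrier G)" "card (carrier G) \<le> 8"
    using card_Q8 bij_betw_finite[OF \<phi>(2)] bij_betw_same_card[OF \<phi>(2)] by simp_all
  \<comment> \<open>The dichotomy \<open>quaternion_commute_or\<close> is pulled back along the
    isomorphism.\<close>
  have flip: "h \<otimes> g \<otimes> h = g"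
    if [simp]: "g \<in> carrier G" "h \<in> carrier G" and "g \<otimes> h \<noteq> h \<otimes> g" for g h
  proof -
    note inj = inj_on_eq_iff[OF bij_betw_imp_inj_on[OF \<phi>(2)]]
    have [simp]: "\<phi> g \<in> carrier Q8" "\<phi> h \<in> carrier Q8"
      using \<phi>(1) by (auto simp: hom_def)
    have "\<phi> g \<otimes>\<^bsub>Q8\<^esub> \<phi> h \<noteq> \<phi> h \<otimes>\<^bsub>Q8\<^esub> \<phi> g"
      using that inj[of "g \<otimes> h" "h \<otimes> g"] by (simp add: hom_mult[OF \<phi>(1)])
    then have "\<phi> h \<otimes>\<^bsub>Q8\<^esub> \<phi> g \<otimes>\<^bsub>Q8\<^esub> \<phi> h = \<phi> g"
      using Q.quaternion_commute_or[of "\<phi> g" "\<phi> h"] by (simp flip: Q8_pair(2))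
    then show ?thesis
      using inj[of "h \<otimes> g \<otimes> h" g] by (simp add: hom_mult[OF \<phi>(1)])
  qed
  have sub: "A \<subseteq> carrier G" and gen: "generate G A = carrier G" and inv: "\<And>a. a \<in> A \<Longrightarrow> inv a \<in> A"
    using A(2) by (auto simp: symmetric_generating_set_def)
  obtain a b where ab: "a \<in> A" "b \<in> A" and N: "a \<otimes> b \<noteq> b \<otimes> a"
    using comm_group_generateI[OF sub gen] nc by blast
  have [simp]: "a \<in> carrier G" "b \<in> carrier G" using ab sub by auto
  interpret quaternion_pair G a b
    using flip[of a b] flip[of b a] N by unfold_locales auto
  have "set (quaternion_list G a b) = carrier G"
    using fin subgroup.subset[OF subgroup_quaternion] distinct_card[OF distinct_quaternion_list[OF N]]
    by (intro card_seteq) (auto simp: quaternion_list_def Let_def)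
  then have "g \<in> set (quaternion_list G a b)" if "g \<in> carrier G" for g
    using that by simp
  moreover have "inv a = a \<otimes> (a \<otimes> a)" "inv b = a \<otimes> (a \<otimes> b)"
    by (rule inv_equality; simp add: m_assoc normalize)+
  \<comment> \<open>The words follow the order of \<open>quaternion_list\<close>, with
    \<open>a^3\<close>, \<open>a^2 b\<close>, \<open>a^3 b\<close> shortened to \<open>a^-1\<close>,
    \<open>b^-1\<close>, \<open>b a\<close>.\<close>
  ultimately have "\<exists>v\<in>set [[], [a], [a, a], [inv a], [b], [a, b], [inv b], [b, a]].
      foldr (\<otimes>) v \<one> = g" if "g \<in> carrier G" for g
    using that by (fastforce simp: set_quaternion_list mult_swap)
  moreover have "set [[], [a], [a, a], [inv a], [b], [a, b], [inv b], [b, a]] \<subseteq>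
      {v \<in> lists A. length v \<le> 2}"
    using ab inv by auto
  ultimately show ?thesis
    by (intro piecewise_excluding_diameter_2 A(1) sub) blast
qed

theorem theorem3p7:
  fixes G :: "('a, 'b) monoid_scheme"
  assumes "group G"
    and "\<not> comm_group G"
    and "\<exists>x\<in>carrier G. \<exists>y\<in>carrier G. generate G {x, y} = carrier G"
  shows "(\<forall>A. finite A \<and> symmetric_generating_set G A \<longrightarrow> piecewise_excluding A (Geo G A))
           \<longleftrightarrow> G \<cong> Q8"
proof
  interpret group G by fact
  assume "\<forall>A. finite A \<and> symmetric_generating_set G A \<longrightarrow> piecewise_excluding A (Geo G A)"
  then interpret piecewise_excluding_group G
    using assms(2) by unfold_locales auto
  obtain x y where P: "gen_pair x y"
    using assms(3) by (auto simp: gen_pair_def)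
  then have "quaternion_pair G x y"
    using gen_pair_quaternion[of x y] gen_pair_quaternion[of y x] gen_pair_closed gen_pair_commute
    by unfold_locales auto
  then show "G \<cong> Q8"
    using P gen_pair_noncommuting[OF P] by (intro quaternion_pair.iso_Q8) (auto simp: gen_pair_def)
next
  assume "G \<cong> Q8"
  then show "\<forall>A. finite A \<and> symmetric_generating_set G A \<longrightarrow> piecewise_excluding A (Geo G A)"
    using group.iso_Q8_piecewise_excluding[OF assms(1)] assms(2) by blast
qed

end
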